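(* Let $G=(V,E)$ be a $\lambda$-expander graph, $l\ge1$, and $f:V\to\{0,1\}$ with $\mu:=\mathbb E_{v\sim U(V)} f(v)$. Let $\gamma$ be real with $\mu+\lambda\le\gamma\le 1$. Then \[ \Pr_{w\sim\mathrm{Walk}(G,l)}\Big(\textstyle\sum_{i\in[l]} f(w_i)\ge \gamma l\Big)\le \exp\big(-l\,D(\gamma\,\|\,\mu+\lambda)\big). \]
   Context: $[l]:=\{0,\dots,l-1\}$; $U(V)$ is the uniform distribution on $V$. $D(p\|q):=p\ln\frac pq+(1-p)\ln\frac{1-p}{1-q}$ is the Kullback–Leibler divergence between Bernoulli distributions (with $0\ln 0=0$ and $\exp(-\infty)=0$). Graphs are finite, undirected, may have parallel edges and self-loops; the adjacency matrix $A=(a_{uv})$ counts edges between $u$ and $v$; the graph is $d$-regular ($d\ge1$) if $A$ is symmetric with all row sums $d$; it is a $\lambda$-expander if it is $d$-regular and the second largest absolute value of the eigenvalues of $A$ (with multiplicity) is at most $d\lambda$. $\mathrm{Walk}(G,l)$ is the distribution of $w=(w_0,\dots,w_{l-1})$ where $w_0$ is uniform on $V$ and $w_{i+1}=u$ with probability $a_{w_iu}/d$ given the past. *)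

theory Defs
  imports "HOL-Probability.Probability" "HOL-Computational_Algebra.Fundamental_Theorem_Algebra"
    "Jordan_Normal_Form.Char_Poly"
begin

text \<open>Graphs: vertex set V = {0..<n}; adjacency matrix A :: nat => nat => nat
  (A u v = number of edges between u and v, self-loops allowed).\<close>

definition regular :: "nat \<Rightarrow> (nat \<Rightarrow> nat \<Rightarrow> nat) \<Rightarrow> nat \<Rightarrow> bool" where
  "regular n A d \<longleftrightarrow> d \<ge> 1 \<and> (\<forall>u<n. \<forall>v<n. A u v = A v u) \<and> (\<forall>u<n. (\<Sum>v<n. A u v) = d)"

definition adj_mat :: "nat \<Rightarrow> (nat \<Rightarrow> nat \<Rightarrow> nat) \<Rightarrow> complex mat" where
  "adj_mat n A = mat n n (\<lambda>(i,j). of_nat (A i j))"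

definition eigenvalues_mset :: "nat \<Rightarrow> (nat \<Rightarrow> nat \<Rightarrow> nat) \<Rightarrow> complex multiset" where
  "eigenvalues_mset n A = proots (char_poly (adj_mat n A))"

text \<open>Second largest absolute value of the eigenvalues (with multiplicity) is at most d*lambda:
  after removing one copy of an eigenvalue of largest absolute value, all remaining ones are
  bounded by d*lambda.\<close>
definition expander :: "nat \<Rightarrow> (nat \<Rightarrow> nat \<Rightarrow> nat) \<Rightarrow> nat \<Rightarrow> real \<Rightarrow> bool" where
  "expander n A d lam \<longleftrightarrow> regular n A d \<and>
     (let M = eigenvalues_mset n A in
       \<exists>e\<in>#M. (\<forall>x\<in>#M. cmod x \<le> cmod e) \<and> (\<forall>x\<in>#M - {#e#}. cmod x \<le> real d * lam))"

definition step_pmf :: "nat \<Rightarrow> (nat \<Rightarrow> nat \<Rightarrow> nat) \<Rightarrow> nat \<Rightarrow> nat pmf" where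
  "step_pmf n A u = pmf_of_multiset (\<Sum>v\<in>{..<n}. replicate_mset (A u v) v)"

fun walk_pmf :: "nat \<Rightarrow> (nat \<Rightarrow> nat \<Rightarrow> nat) \<Rightarrow> nat \<Rightarrow> nat list pmf" where
  "walk_pmf n A 0 = return_pmf []"
| "walk_pmf n A (Suc l) =
     (if l = 0 then map_pmf (\<lambda>v. [v]) (pmf_of_set {..<n})
      else bind_pmf (walk_pmf n A l) (\<lambda>w. map_pmf (\<lambda>v. w @ [v]) (step_pmf n A (last w))))"

definition kl_term :: "real \<Rightarrow> real \<Rightarrow> ereal" where
  "kl_term a b = (if a = 0 then 0 else if b = 0 then \<infinity> else ereal (a * ln (a / b)))"

definition KL :: "real \<Rightarrow> real \<Rightarrow> ereal" where
  "KL p q = kl_term p q + kl_term (1 - p) (1 - q)"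

definition exp_ereal :: "ereal \<Rightarrow> real" where
  "exp_ereal x = (case x of ereal r \<Rightarrow> exp r | MInfty \<Rightarrow> 0 | PInfty \<Rightarrow> 0)"

end

theory Submission
  imports Defs "HOL-Real_Asymp.Real_Asymp"
begin

text \<open>
  A Chernoff bound. Let \<open>M = A/d\<close>, let \<open>J\<close> be the averaging projection and \<open>D = diag(e\<^bsup>t f\<^esup>)\<close> for some
  \<open>t \<ge> 0\<close>. The expansion hypothesis says \<open>|Mx| \<le> \<lambda>|x|\<close> for \<open>x\<close> orthogonal to the constants, so
  \<open>M - (1 - \<lambda>)J\<close> has norm at most \<open>\<lambda>\<close>, and \<open>D\<^bsup>1/2\<^esup> M D\<^bsup>1/2\<^esup>\<close> has norm at most
  \<open>(1 - \<lambda>)(1 + \<mu>(e\<^sup>t - 1)) + \<lambda>e\<^sup>t \<le> 1 + (\<mu> + \<lambda>)(e\<^sup>t - 1)\<close>. Hence the moment generating function of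
  the number of hits of a walk of length \<open>l\<close> is at most \<open>(1 + (\<mu> + \<lambda>)(e\<^sup>t - 1))\<^sup>l\<close>, that of a binomial
  variable with parameters \<open>l\<close> and \<open>\<mu> + \<lambda>\<close>; Markov's inequality with optimal \<open>t\<close> gives the divergence.
\<close>

subsection \<open>Eigenvectors orthogonal to the constants\<close>

definition dot :: "nat \<Rightarrow> (nat \<Rightarrow> real) \<Rightarrow> (nat \<Rightarrow> real) \<Rightarrow> real" where
  "dot n x y = (\<Sum>i<n. x i * y i)"

definition mul_vec :: "nat \<Rightarrow> (nat \<Rightarrow> nat \<Rightarrow> real) \<Rightarrow> (nat \<Rightarrow> real) \<Rightarrow> nat \<Rightarrow> real" where
  "mul_vec n S x u = (\<Sum>v<n. S u v * x v)"

lemma dot_commute: "dot n x y = dot n y x"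
  by (simp add: dot_def mult.commute)

lemma dot_add_left: "dot n (\<lambda>i. x i + y i) z = dot n x z + dot n y z"
  by (simp add: dot_def algebra_simps sum.distrib)

lemma dot_scale_left: "dot n (\<lambda>i. c * x i) z = c * dot n x z"
  by (simp add: dot_def algebra_simps sum_distrib_left)

lemma dot_add_right: "dot n z (\<lambda>i. x i + y i) = dot n z x + dot n z y"
  by (simp add: dot_def algebra_simps sum.distrib)

lemma dot_scale_right: "dot n z (\<lambda>i. c * x i) = c * dot n z x"
  by (simp add: dot_def algebra_simps sum_distrib_left)

lemmas dot_simps = dot_add_left dot_add_right dot_scale_left dot_scale_right

lemma dot_cong: "(\<And>i. i < n \<Longrightarrow> x i = x' i) \<Longrightarrow> (\<And>i. i < n \<Longrightarrow> y i = y' i) \<Longrightarrow> dot n x y = dot n x' y'"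
  by (simp add: dot_def)

lemma dot_self_nonneg: "0 \<le> dot n x x"
  by (simp add: dot_def sum_nonneg)

lemma dot_self_eq_0_iff: "dot n x x = 0 \<longleftrightarrow> (\<forall>i<n. x i = 0)"
  by (auto simp: dot_def sum_nonneg_eq_0_iff)

lemma dot_Cauchy_Schwarz: "\<bar>dot n x y\<bar> \<le> sqrt (dot n x x) * sqrt (dot n y y)"
  using L2_set_mult_ineq[of "\<lambda>i. x i" "\<lambda>i. y i" "{..<n}"]
    sum_abs[of "\<lambda>i. x i * y i" "{..<n}"]
  by (simp add: dot_def L2_set_def abs_mult power2_eq_square)

lemma mul_vec_cong: "(\<And>i. i < n \<Longrightarrow> x i = y i) \<Longrightarrow> mul_vec n S x = mul_vec n S y"
  by (simp add: mul_vec_def fun_eq_iff)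

lemma mul_vec_add: "mul_vec n S (\<lambda>i. x i + y i) = (\<lambda>u. mul_vec n S x u + mul_vec n S y u)"
  by (simp add: mul_vec_def algebra_simps sum.distrib fun_eq_iff)

lemma mul_vec_scale: "mul_vec n S (\<lambda>i. c * x i) = (\<lambda>u. c * mul_vec n S x u)"
  by (simp add: mul_vec_def algebra_simps sum_distrib_left fun_eq_iff)

lemma dot_mul_vec_symmetric:
  assumes "\<And>u v. u < n \<Longrightarrow> v < n \<Longrightarrow> S u v = S v u"
  shows "dot n (mul_vec n S x) y = dot n x (mul_vec n S y)"
proof -
  have "dot n (mul_vec n S x) y = (\<Sum>u<n. \<Sum>v<n. S u v * x v * y u)"
    by (simp add: dot_def mul_vec_def sum_distrib_right)
  also have "\<dots> = (\<Sum>v<n. \<Sum>u<n. S u v * x v * y u)"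
    by (rule sum.swap)
  also have "\<dots> = dot n x (mul_vec n S y)"
    unfolding dot_def mul_vec_def sum_distrib_left
    by (intro sum.cong refl) (use assms in \<open>simp add: mult_ac\<close>)
  finally show ?thesis .
qed

text \<open>Vectors are functions on all of \<open>nat\<close>, so coordinates from \<open>n\<close>
  on are pinned to 0. The set is then closed inside a product of compact sets,
  \<open>{-1..1}\<close> below \<open>n\<close> and \<open>{0}\<close> above, and Tychonoff's
  theorem applies.\<close>

lemma compact_unit_sphere_sum_zero:
  "compact {x :: nat \<Rightarrow> real. (\<forall>i\<ge>n. x i = 0) \<and> (\<Sum>i<n. x i) = 0 \<and> dot n x x = 1}"
    (is "compact ?K")
proof -
  define B where "B = Pi UNIV (\<lambda>i. if i < n then {-1..1::real} else {0})"
  have "compactin (product_topology (\<lambda>_. euclidean) UNIV)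
      (PiE UNIV (\<lambda>i. if i < n then {-1..1::real} else {0}))"
    unfolding compactin_PiE by auto
  then have "compact B"
    unfolding euclidean_product_topology compactin_euclidean_iff B_def PiE_UNIV_domain .
  have c: "continuous_on UNIV (\<lambda>x::nat \<Rightarrow> real. x i)" for i
    by (rule continuous_on_product_coordinates)
  have "closed ({x :: nat \<Rightarrow> real. (\<Sum>i<n. x i) = 0} \<inter> {x. dot n x x = 1})"
    unfolding dot_def
    by (intro closed_Int closed_Collect_eq continuous_intros c)
  with \<open>compact B\<close> have "compact (B \<inter> ({x. (\<Sum>i<n. x i) = 0} \<inter> {x. dot n x x = 1}))"
    by (rule compact_Int_closed)
  moreover have "x \<in> B" if x: "x \<in> ?K" for x
  proof -
    have "\<bar>x i\<bar> \<le> 1" if "i < n" for i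
    proof -
      have "x i * x i \<le> dot n x x"
        unfolding dot_def using that by (intro member_le_sum) auto
      then show ?thesis using x by (simp add: abs_square_le_1[symmetric] power2_eq_square)
    qed
    then show ?thesis using x by (auto simp: B_def abs_le_iff minus_le_iff)
  qed
  then have "?K = B \<inter> ({x. (\<Sum>i<n. x i) = 0} \<inter> {x. dot n x x = 1})"
    by (auto simp: B_def Pi_iff split: if_splits)
  ultimately show ?thesis by simp
qed

text \<open>Constant row sums make the all-one vector an eigenvector; by symmetry of
  \<open>S\<close> its orthogonal complement is invariant.\<close>

lemma sum_mul_vec_eq_0:
  assumes sym: "\<And>u v. u < n \<Longrightarrow> v < n \<Longrightarrow> S u v = S v u"
    and row: "\<And>u. u < n \<Longrightarrow> (\<Sum>v<n. S u v) = d"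
    and "(\<Sum>i<n. x i) = 0"
  shows "(\<Sum>i<n. mul_vec n S x i) = 0"
proof -
  have "(\<Sum>i<n. mul_vec n S x i) = dot n (mul_vec n S x) (\<lambda>_. 1)"
    by (simp add: dot_def)
  also have "\<dots> = dot n x (mul_vec n S (\<lambda>_. 1))"
    by (rule dot_mul_vec_symmetric[OF sym])
  also have "\<dots> = dot n x (\<lambda>_. d * 1)"
    by (rule dot_cong) (use row in \<open>simp_all add: mul_vec_def\<close>)
  also have "\<dots> = d * (\<Sum>i<n. x i)"
    by (simp add: dot_def sum_distrib_left mult.commute)
  finally show ?thesis using assms(3) by simp
qed

text \<open>The maximum of \<open>|Sx|\<^sup>2\<close> on the unit sphere of the complement of the constants is attained
  at an eigenvector of \<open>S\<^sup>2\<close> with eigenvalue \<open>s\<^sup>2\<close>; since \<open>(S - s)(S + s) z = 0\<close>, either \<open>z\<close> or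
  \<open>(S + s) z\<close> is an eigenvector of \<open>S\<close>.\<close>

lemma exists_extremal_eigenvector:
  fixes S :: "nat \<Rightarrow> nat \<Rightarrow> real"
  assumes sym: "\<And>u v. u < n \<Longrightarrow> v < n \<Longrightarrow> S u v = S v u"
    and row: "\<And>u. u < n \<Longrightarrow> (\<Sum>v<n. S u v) = d"
    and y: "(\<Sum>i<n. y i) = 0" "dot n y y \<noteq> 0"
  obtains z \<theta> where "(\<Sum>i<n. z i) = 0" "dot n z z \<noteq> 0"
    "\<And>i. i < n \<Longrightarrow> mul_vec n S z i = \<theta> * z i"
    "\<And>x. (\<Sum>i<n. x i) = 0 \<Longrightarrow> dot n (mul_vec n S x) (mul_vec n S x) \<le> \<theta>\<^sup>2 * dot n x x"
proof -
  define K where "K = {x :: nat \<Rightarrow> real. (\<forall>i\<ge>n. x i = 0) \<and> (\<Sum>i<n. x i) = 0 \<and> dot n x x = 1}"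
  define q where "q x = dot n (mul_vec n S x) (mul_vec n S x)" for x
  define nrm where "nrm x = (\<lambda>i. if i < n then (1 / sqrt (dot n x x)) * x i else 0)" for x
  have nrm_cong: "dot n (nrm x) (nrm x) = (1 / dot n x x) * dot n x x"
    "q (nrm x) = (1 / dot n x x) * q x" for x
  proof -
    have "dot n (nrm x) (nrm x) =
        dot n (\<lambda>i. (1 / sqrt (dot n x x)) * x i) (\<lambda>i. (1 / sqrt (dot n x x)) * x i)"
      by (rule dot_cong) (simp_all add: nrm_def)
    then show "dot n (nrm x) (nrm x) = (1 / dot n x x) * dot n x x"
      by (simp only: dot_simps) (simp add: dot_self_nonneg flip: power2_eq_square)
    have "mul_vec n S (nrm x) = mul_vec n S (\<lambda>i. (1 / sqrt (dot n x x)) * x i)"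
      by (rule mul_vec_cong) (simp add: nrm_def)
    also have "\<dots> = (\<lambda>u. (1 / sqrt (dot n x x)) * mul_vec n S x u)"
      by (simp only: mul_vec_scale)
    finally show "q (nrm x) = (1 / dot n x x) * q x"
      unfolding q_def by (simp only: dot_simps) (simp add: dot_self_nonneg)
  qed
  have nrm_K: "nrm x \<in> K" if "(\<Sum>i<n. x i) = 0" "dot n x x \<noteq> 0" for x
    using that nrm_cong(1)[of x]
    by (auto simp: K_def nrm_def sum_divide_distrib[symmetric])
  have "compact K" unfolding K_def by (rule compact_unit_sphere_sum_zero)
  have "K \<noteq> {}" using nrm_K[OF y] by auto
  have "continuous_on K q"
    unfolding q_def dot_def mul_vec_def
    by (intro continuous_intros continuous_on_subset[OF continuous_on_product_coordinates]) auto
  from continuous_attains_sup[OF \<open>compact K\<close> \<open>K \<noteq> {}\<close> this]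
  obtain z where z: "z \<in> K" and max: "\<And>x. x \<in> K \<Longrightarrow> q x \<le> q z"
    by blast
  define s where "s = sqrt (q z)"
  have s2: "s\<^sup>2 = q z" by (simp add: s_def q_def dot_self_nonneg)
  have bound: "q x \<le> s\<^sup>2 * dot n x x" if x: "(\<Sum>i<n. x i) = 0" for x
  proof (cases "dot n x x = 0")
    case True
    then have "mul_vec n S x = mul_vec n S (\<lambda>_. 0)"
      by (intro mul_vec_cong) (simp add: dot_self_eq_0_iff)
    then have "q x = 0" by (simp add: q_def dot_def mul_vec_def)
    then show ?thesis using True by simp
  next
    case False
    then have "dot n x x > 0" using dot_self_nonneg[of n x] by simp
    moreover have "q (nrm x) \<le> s\<^sup>2" using max[OF nrm_K[OF x False]] s2 by simp
    ultimately show ?thesis unfolding nrm_cong by (simp add: field_simps)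
  qed
  have z0: "(\<Sum>i<n. z i) = 0" and z1: "dot n z z = 1" using z by (auto simp: K_def)
  \<comment> \<open>\<open>r\<close> is half the gradient at \<open>z\<close> of the form
    \<open>s\<^sup>2|x|\<^sup>2 - |Sx|\<^sup>2\<close>, so pairing with \<open>r\<close> evaluates
    the associated bilinear form at \<open>z\<close>. The aim is \<open>r = 0\<close>.\<close>
  define r where "r = (\<lambda>i. s\<^sup>2 * z i + (-1) * mul_vec n S (mul_vec n S z) i)"
  have r0: "(\<Sum>i<n. r i) = 0"
    using z0 sum_mul_vec_eq_0[OF sym row sum_mul_vec_eq_0[OF sym row z0]]
    by (simp add: r_def sum_subtractf flip: sum_distrib_left)
  have rr: "dot n r y = s\<^sup>2 * dot n z y - dot n (mul_vec n S z) (mul_vec n S y)" for y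
    unfolding r_def by (simp only: dot_simps dot_mul_vec_symmetric[OF sym, where x = "mul_vec n S z"])
  txt \<open>The form \<open>s\<^sup>2|x|\<^sup>2 - |Sx|\<^sup>2\<close> is positive semidefinite and vanishes at \<open>z\<close>, so \<open>z\<close> is in its radical.\<close>
  have "dot n r r = 0"
  proof (rule ccontr)
    assume "dot n r r \<noteq> 0"
    then have pos: "dot n r r > 0" using dot_self_nonneg[of n r] by simp
    define c where "c = s\<^sup>2 * dot n r r - q r"
    have c: "c \<ge> 0" using bound[OF r0] by (simp add: c_def)
    have *: "0 \<le> 2 * t * dot n r r + t\<^sup>2 * c" for t
    proof -
      have "(\<Sum>i<n. z i + t * r i) = 0"
        using z0 r0 by (simp add: sum.distrib flip: sum_distrib_left)
      from bound[OF this]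
      have "q (\<lambda>i. z i + t * r i) \<le> s\<^sup>2 * dot n (\<lambda>i. z i + t * r i) (\<lambda>i. z i + t * r i)" .
      moreover have "q (\<lambda>i. z i + t * r i) =
          q z + 2 * t * dot n (mul_vec n S z) (mul_vec n S r) + t\<^sup>2 * q r"
        unfolding q_def mul_vec_add mul_vec_scale dot_simps
        by (simp add: dot_commute[of n "mul_vec n S r" "mul_vec n S z"] power2_eq_square algebra_simps)
      moreover have "dot n (\<lambda>i. z i + t * r i) (\<lambda>i. z i + t * r i) =
          1 + 2 * t * dot n z r + t\<^sup>2 * dot n r r"
        unfolding dot_simps
        by (simp add: dot_commute[of n r z] power2_eq_square algebra_simps z1)
      ultimately have "0 \<le> s\<^sup>2 * (1 + 2 * t * dot n z r + t\<^sup>2 * dot n r r)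
          - (q z + 2 * t * dot n (mul_vec n S z) (mul_vec n S r) + t\<^sup>2 * q r)"
        by simp
      also have "\<dots> = 2 * t * (s\<^sup>2 * dot n z r - dot n (mul_vec n S z) (mul_vec n S r)) + t\<^sup>2 * c"
        using s2 by (simp add: c_def algebra_simps)
      also have "\<dots> = 2 * t * dot n r r + t\<^sup>2 * c"
        using rr[of r] by simp
      finally show ?thesis .
    qed
    \<comment> \<open>A small step from \<open>z\<close> against the gradient would make the form
      negative. Dividing by \<open>c + 1\<close> instead of \<open>c\<close> covers
      \<open>c = 0\<close> and leaves \<open>- e\<^sup>2 * (c + 2)\<close>.\<close>
    define e where "e = dot n r r / (c + 1)"
    have e: "e > 0" "dot n r r = e * (c + 1)" using c pos by (auto simp: e_def)
    have "0 \<le> 2 * (- e) * dot n r r + (- e)\<^sup>2 * c"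
      by (rule *)
    also have "\<dots> = e\<^sup>2 * (- 2 * (c + 1) + c)"
      unfolding e(2) by (simp add: power2_eq_square algebra_simps)
    also have "\<dots> < 0" using c e(1) by (intro mult_pos_neg) auto
    finally show False by simp
  qed
  then have zz: "mul_vec n S (mul_vec n S z) i = s\<^sup>2 * z i" if "i < n" for i
    using that by (simp add: dot_self_eq_0_iff r_def)
  define w where "w = (\<lambda>i. mul_vec n S z i + s * z i)"
  show thesis
  proof (cases "dot n w w = 0")
    case True
    have "mul_vec n S z i = (- s) * z i" if "i < n" for i
      using that True by (auto simp: dot_self_eq_0_iff w_def eq_neg_iff_add_eq_0)
    with z0 z1 bound show thesis by (intro that[of z "- s"]) (auto simp: q_def)
  next
    case False
    have "mul_vec n S w i = s * w i" if "i < n" for i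
      using zz[OF that] by (simp add: w_def mul_vec_add mul_vec_scale power2_eq_square algebra_simps)
    moreover have "(\<Sum>i<n. w i) = 0"
      using z0 sum_mul_vec_eq_0[OF sym row z0] by (simp add: w_def sum.distrib flip: sum_distrib_left)
    ultimately show thesis using False bound by (intro that[of w s]) (auto simp: q_def)
  qed
qed

subsection \<open>Contraction by expanders\<close>

lemma char_poly_root_of_eigenvector:
  fixes B :: "nat \<Rightarrow> nat \<Rightarrow> 'a :: field"
  assumes eq: "\<And>i. i < n \<Longrightarrow> (\<Sum>j<n. B i j * x j) = k * x i" and "i < n" "x i \<noteq> 0"
  shows "poly (char_poly (mat n n (\<lambda>(i, j). B i j))) k = 0"
proof -
  let ?M = "mat n n (\<lambda>(i, j). B i j)"
  have "eigenvector ?M (vec n x) k"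
    unfolding eigenvector_def
  proof (intro conjI)
    show "?M *\<^sub>v vec n x = k \<cdot>\<^sub>v vec n x"
      by (rule eq_vecI) (simp_all add: scalar_prod_def eq lessThan_atLeast0[symmetric])
    show "vec n x \<noteq> 0\<^sub>v (dim_row ?M)"
      using assms(2,3) by (auto simp: vec_eq_iff)
  qed simp
  then show ?thesis
    by (subst eigenvalue_root_char_poly[symmetric, of _ n]) (auto simp: eigenvalue_def)
qed

text \<open>The derivative of the characteristic polynomial is the sum of those of the principal minors,
  and subtracting a multiple of the all-one eigenvector from \<open>z\<close> yields an eigenvector of each minor.\<close>

lemma order_char_poly_ge_2:
  fixes B :: "nat \<Rightarrow> nat \<Rightarrow> 'a :: field_char_0"
  assumes row: "\<And>i. i < n \<Longrightarrow> (\<Sum>j<n. B i j) = k"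
    and eq: "\<And>i. i < n \<Longrightarrow> (\<Sum>j<n. B i j * z j) = k * z i"
    and nonconst: "a < n" "b < n" "z a \<noteq> z b"
  shows "order k (char_poly (mat n n (\<lambda>(i, j). B i j))) \<ge> 2"
proof -
  let ?M = "mat n n (\<lambda>(i, j). B i j)" and ?p = "char_poly (mat n n (\<lambda>(i, j). B i j))"
  have M: "?M \<in> carrier_mat n n" by simp
  have "poly (char_poly (mat_delete ?M i i)) k = 0" if i: "i < n" for i
  proof -
    \<comment> \<open>\<open>\<iota>\<close> is the renumbering of indices done by
      \<open>mat_delete\<close>. The shift makes \<open>y\<close> vanish at \<open>i\<close>, so
      deleting row and column \<open>i\<close> leaves the eigenvalue equations of the other rows
      intact.\<close>
    define \<iota> where "\<iota> c = (if c < i then c else Suc c)" for c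
    define y where "y j = z j - z i" for j
    have bij: "bij_betw \<iota> {..<n - 1} ({..<n} - {i})"
      by (rule bij_betw_byWitness[where f' = "\<lambda>c. if c < i then c else c - 1"])
        (use i in \<open>auto simp: \<iota>_def\<close>)
    have yi: "y i = 0" by (simp add: y_def)
    have y: "(\<Sum>j<n. B c j * y j) = k * y c" if "c < n" for c
      using eq[OF that] row[OF that]
      by (simp add: y_def right_diff_distrib sum_subtractf flip: sum_distrib_right)
    have "(\<Sum>c<n - 1. B (\<iota> r) (\<iota> c) * y (\<iota> c)) = k * y (\<iota> r)" if "r < n - 1" for r
    proof -
      have "(\<Sum>c<n - 1. B (\<iota> r) (\<iota> c) * y (\<iota> c)) = (\<Sum>j\<in>{..<n} - {i}. B (\<iota> r) j * y j)"
        by (rule sum.reindex_bij_betw[OF bij])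
      also have "\<dots> = (\<Sum>j<n. B (\<iota> r) j * y j)"
        by (rule sum.mono_neutral_left) (auto simp: yi)
      also have "\<dots> = k * y (\<iota> r)"
        using bij_betwE[OF bij] that by (intro y) auto
      finally show ?thesis .
    qed
    moreover have "\<exists>r<n - 1. y (\<iota> r) \<noteq> 0"
    proof -
      have "y a \<noteq> 0 \<or> y b \<noteq> 0" using nonconst by (auto simp: y_def)
      then obtain j where j: "j < n" "y j \<noteq> 0" using nonconst by blast
      then have "j \<in> {..<n} - {i}" using yi by auto
      then obtain r where "r < n - 1" "j = \<iota> r"
        using bij by (auto simp: bij_betw_def)
      then show ?thesis using j by auto
    qed
    ultimately have "poly (char_poly (mat (n - 1) (n - 1) (\<lambda>(r, c). B (\<iota> r) (\<iota> c)))) k = 0"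
      using char_poly_root_of_eigenvector[of "n - 1" "\<lambda>r c. B (\<iota> r) (\<iota> c)" "\<lambda>r. y (\<iota> r)" k] by auto
    also have "mat (n - 1) (n - 1) (\<lambda>(r, c). B (\<iota> r) (\<iota> c)) = mat_delete ?M i i"
      by (rule eq_matI) (auto simp: mat_delete_def \<iota>_def)
    finally show ?thesis .
  qed
  then have "poly (pderiv ?p) k = 0"
    by (simp add: pderiv_char_poly[OF M] poly_sum)
  moreover have "?p \<noteq> 0" and deg: "degree ?p = n"
    using degree_monic_char_poly[OF M] by auto
  \<comment> \<open>In characteristic 0 the derivative vanishes only for constants, and
    \<open>a < n\<close> forces positive degree. So \<open>order_pderiv\<close> applies, and a
    common root of \<open>?p\<close> and its derivative has order at least 2.\<close>
  moreover have "pderiv ?p \<noteq> 0"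
    using deg nonconst by (auto simp: pderiv_eq_0_iff)
  moreover have "poly ?p k = 0"
    using char_poly_root_of_eigenvector[of n B "\<lambda>_. 1" k a] row nonconst by simp
  ultimately show ?thesis
    using order_pderiv[of ?p k] by (auto simp: order_root)
qed

text \<open>Compare both sides of the eigenvalue equation at a coordinate where \<open>z\<close> has
  maximal modulus \<open>m\<close>: the row sum is at most \<open>d * m\<close> there.\<close>

lemma abs_eigenvalue_le_row_sum:
  fixes S :: "nat \<Rightarrow> nat \<Rightarrow> real"
  assumes nonneg: "\<And>u v. S u v \<ge> 0"
    and row: "\<And>u. u < n \<Longrightarrow> (\<Sum>v<n. S u v) = d"
    and eq: "\<And>i. i < n \<Longrightarrow> mul_vec n S z i = \<theta> * z i"
    and nz: "dot n z z \<noteq> 0"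
  shows "\<bar>\<theta>\<bar> \<le> d"
proof -
  obtain i where i: "i < n" "z i \<noteq> 0" using nz by (auto simp: dot_self_eq_0_iff)
  define m where "m = Max ((\<lambda>i. \<bar>z i\<bar>) ` {..<n})"
  have le: "\<bar>z j\<bar> \<le> m" if "j < n" for j
    unfolding m_def using that by (intro Max_ge) auto
  have "m \<in> (\<lambda>i. \<bar>z i\<bar>) ` {..<n}"
    unfolding m_def using i by (intro Max_in) auto
  then obtain j where j: "j < n" "\<bar>z j\<bar> = m" by auto
  have "m > 0" using le[OF i(1)] i(2) by linarith
  have "\<bar>\<theta>\<bar> * m = \<bar>mul_vec n S z j\<bar>" by (simp add: eq j abs_mult)
  also have "\<dots> \<le> (\<Sum>v<n. \<bar>S j v * z v\<bar>)" unfolding mul_vec_def by (rule sum_abs)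
  also have "\<dots> \<le> (\<Sum>v<n. S j v * m)"
    by (intro sum_mono) (auto simp: abs_mult nonneg le intro!: mult_left_mono)
  also have "\<dots> = d * m" using row[OF j(1)] by (simp flip: sum_distrib_right)
  finally show ?thesis using \<open>m > 0\<close> by simp
qed

lemma regular_row_sum:
  assumes "regular n A d" "u < n"
  shows "(\<Sum>v<n. of_nat (A u v)) = (of_nat d :: 'a :: semiring_1)"
proof -
  have "(\<Sum>v<n. A u v) = d" using assms unfolding regular_def by blast
  then have "of_nat (\<Sum>v<n. A u v) = (of_nat d :: 'a)" by simp
  then show ?thesis by simp
qed

text \<open>By extremality it suffices to bound the eigenvalue \<open>\<theta>\<close> by
  \<open>d * lam\<close>. The definition of \<open>expander\<close> does not say which eigenvalue
  \<open>e\<close> is removed. If it is not \<open>\<theta>\<close>, then \<open>\<theta>\<close>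
  remains and is bounded directly. If it is \<open>\<theta>\<close>, then a copy of \<open>d\<close>
  remains, so \<open>d \<le> d * lam\<close>, and \<open>|\<theta>| \<le> d\<close>
  finishes.\<close>

lemma expander_contracts_sum_zero:
  assumes ex: "expander n A d lam" and "lam \<ge> 0" and y0: "(\<Sum>i<n. y i) = 0"
  defines "S \<equiv> \<lambda>u v. real (A u v)"
  shows "dot n (mul_vec n S y) (mul_vec n S y) \<le> (real d * lam)\<^sup>2 * dot n y y"
proof (cases "dot n y y = 0")
  case True
  then have "mul_vec n S y = mul_vec n S (\<lambda>_. 0)"
    by (intro mul_vec_cong) (simp add: dot_self_eq_0_iff)
  then show ?thesis using True by (simp add: dot_def mul_vec_def)
next
  case False
  from ex have reg: "regular n A d" by (simp add: expander_def)
  have sym: "S u v = S v u" if "u < n" "v < n" for u v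
    using reg that by (simp add: S_def regular_def)
  have row: "(\<Sum>v<n. S u v) = real d" if "u < n" for u
    unfolding S_def by (rule regular_row_sum[OF reg that])
  obtain z \<theta> where z0: "(\<Sum>i<n. z i) = 0" and nz: "dot n z z \<noteq> 0"
    and eig: "\<And>i. i < n \<Longrightarrow> mul_vec n S z i = \<theta> * z i"
    and bound: "\<And>x. (\<Sum>i<n. x i) = 0 \<Longrightarrow> dot n (mul_vec n S x) (mul_vec n S x) \<le> \<theta>\<^sup>2 * dot n x x"
  proof (rule exists_extremal_eigenvector[of n S "real d" y, OF _ _ y0 False], goal_cases)
    case (1 u v)
    from 1(2-) show ?case by (rule sym)
  next
    case (2 u)
    from 2(2-) show ?case by (rule row)
  next
    case (3 z \<theta>)
    from 3(2-) show ?case by (rule 3(1))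
  qed
  define M where "M = eigenvalues_mset n A"
  have M_eq: "M = proots (char_poly (mat n n (\<lambda>(i, j). of_nat (A i j))))"
    by (simp add: M_def eigenvalues_mset_def adj_mat_def)
  have p0: "char_poly (mat n n (\<lambda>(i, j). of_nat (A i j) :: complex)) \<noteq> 0"
    using degree_monic_char_poly[of "mat n n (\<lambda>(i, j). of_nat (A i j) :: complex)" n] by auto
  obtain a where a: "a < n" "z a \<noteq> 0" using nz by (auto simp: dot_self_eq_0_iff)
  have eigc: "(\<Sum>j<n. of_nat (A i j) * complex_of_real (z j)) = of_real \<theta> * of_real (z i)"
    if "i < n" for i
  proof -
    have "(\<Sum>j<n. of_nat (A i j) * complex_of_real (z j)) = of_real (mul_vec n S z i)"
      by (simp add: mul_vec_def S_def)
    then show ?thesis by (simp add: eig[OF that])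
  qed
  have rowc: "(\<Sum>j<n. of_nat (A i j)) = (of_nat d :: complex)" if "i < n" for i
    by (rule regular_row_sum[OF reg that])
  have \<theta>_in: "of_real \<theta> \<in># M"
    using char_poly_root_of_eigenvector[of n _ "\<lambda>i. complex_of_real (z i)", OF eigc] a p0
    by (simp add: M_eq)
  have d_in: "of_nat d \<in># M"
    using char_poly_root_of_eigenvector[of n "\<lambda>i j. of_nat (A i j)" "\<lambda>_. 1" "of_nat d :: complex" a]
      a p0 rowc by (simp add: M_eq)
  have \<theta>_le: "\<bar>\<theta>\<bar> \<le> real d"
    by (rule abs_eigenvalue_le_row_sum[OF _ row eig nz]) (auto simp: S_def)
  from ex obtain e where e: "e \<in># M" and rest: "\<And>x. x \<in># M - {#e#} \<Longrightarrow> cmod x \<le> real d * lam"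
    by (auto simp: expander_def Let_def M_def)
  have "\<bar>\<theta>\<bar> \<le> real d * lam"
  proof (cases "e = of_real \<theta>")
    case False
    then have "of_real \<theta> \<in># M - {#e#}" using \<theta>_in by (simp add: in_diff_count)
    from rest[OF this] show ?thesis by simp
  next
    case True
    have "of_nat d \<in># M - {#e#}"
    proof (cases "\<theta> = real d")
      case False
      then have "complex_of_real \<theta> \<noteq> of_nat d" by (metis of_real_eq_iff of_real_of_nat_eq)
      then show ?thesis using d_in True by (simp add: in_diff_count)
    next
      case \<theta>: True
      \<comment> \<open>When \<open>\<theta> = d\<close>, removing one copy leaves another only if
        \<open>d\<close> is a multiple root; this needs a nonconstant eigenvector, and a nonzero
        vector with sum zero is one.\<close>
      have "\<exists>b<n. z b \<noteq> z a"
      proof (rule ccontr)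
        assume "\<not> ?thesis"
        then have "(\<Sum>i<n. z i) = (\<Sum>i<n. z a)" by (intro sum.cong) auto
        then show False using z0 a by simp
      qed
      then obtain b where b: "b < n" "z b \<noteq> z a" by blast
      have "order (of_nat d) (char_poly (mat n n (\<lambda>(i, j). of_nat (A i j) :: complex))) \<ge> 2"
        using order_char_poly_ge_2[of n "\<lambda>i j. of_nat (A i j) :: complex" "of_nat d" "\<lambda>i. of_real (z i)" b a]
          rowc eigc a b \<theta> by simp
      then have "count M (of_nat d) \<ge> 2" using p0 by (simp add: M_eq)
      then show ?thesis using True \<theta> by (simp add: in_diff_count)
    qed
    from rest[OF this] have "real d \<le> real d * lam" by simp
    then show ?thesis using \<theta>_le by simp
  qed
  then have "\<theta>\<^sup>2 \<le> (real d * lam)\<^sup>2"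
    by (simp add: abs_le_square_iff[symmetric])
  then have "\<theta>\<^sup>2 * dot n y y \<le> (real d * lam)\<^sup>2 * dot n y y"
    by (rule mult_right_mono) (rule dot_self_nonneg)
  with bound[OF y0] show ?thesis by linarith
qed

text \<open>\<open>R\<close> is \<open>d\<close> times \<open>M - (1 - \<lambda>)J\<close>. Split
  \<open>x\<close> into its mean \<open>m\<close> and the centered part \<open>y\<close>:
  \<open>R\<close> scales the constant part by \<open>d * lam\<close> and acts on \<open>y\<close>
  as \<open>S\<close>. The two images are orthogonal, so the squared bounds add up.\<close>

lemma expander_centered_norm_le:
  assumes ex: "expander n A d lam" and "lam \<ge> 0" "n \<ge> 1"
  defines "S \<equiv> \<lambda>u v. real (A u v)"
  defines "R \<equiv> \<lambda>x u. mul_vec n S x u - real d * (1 - lam) * ((\<Sum>i<n. x i) / real n)"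
  shows "dot n (R x) (R x) \<le> (real d * lam)\<^sup>2 * dot n x x"
proof -
  define m where "m = (\<Sum>i<n. x i) / real n"
  define y where "y i = x i - m" for i
  have y0: "(\<Sum>i<n. y i) = 0"
    using \<open>n \<ge> 1\<close> by (simp add: y_def m_def sum_subtractf)
  from ex have reg: "regular n A d" by (simp add: expander_def)
  have sym: "S u v = S v u" if "u < n" "v < n" for u v
    using reg that by (simp add: S_def regular_def)
  have row: "(\<Sum>v<n. S u v) = real d" if "u < n" for u
    unfolding S_def by (rule regular_row_sum[OF reg that])
  have Sy0: "(\<Sum>i<n. mul_vec n S y i) = 0"
    by (rule sum_mul_vec_eq_0[of n S "real d", OF _ _ y0]) (use sym row in auto)
  have R: "R x u = real d * lam * m + mul_vec n S y u" if "u < n" for u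
  proof -
    have "mul_vec n S y u = mul_vec n S x u - (\<Sum>v<n. S u v) * m"
      by (simp add: mul_vec_def y_def right_diff_distrib sum_subtractf sum_distrib_right)
    moreover have "R x u = mul_vec n S x u - real d * (1 - lam) * m"
      by (simp only: R_def m_def)
    ultimately show ?thesis using row[OF that] by (simp add: algebra_simps)
  qed
  have "dot n (R x) (R x) =
      (\<Sum>u<n. (real d * lam * m + mul_vec n S y u) * (real d * lam * m + mul_vec n S y u))"
    by (simp add: dot_def R)
  also have "\<dots> = (\<Sum>u<n. (real d * lam)\<^sup>2 * m\<^sup>2 + 2 * (real d * lam * m) * mul_vec n S y u
      + mul_vec n S y u * mul_vec n S y u)"
    by (intro sum.cong) (simp_all add: power2_eq_square algebra_simps)
  also have "\<dots> = (real d * lam)\<^sup>2 * (real n * m\<^sup>2) + dot n (mul_vec n S y) (mul_vec n S y)"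
    using Sy0 by (simp add: sum.distrib dot_def flip: sum_distrib_left)
  also have "\<dots> \<le> (real d * lam)\<^sup>2 * (real n * m\<^sup>2) + (real d * lam)\<^sup>2 * dot n y y"
    using expander_contracts_sum_zero[OF ex \<open>lam \<ge> 0\<close> y0] by (simp add: S_def)
  also have "\<dots> = (real d * lam)\<^sup>2 * dot n x x"
  proof -
    have "dot n x x = (\<Sum>i<n. m\<^sup>2 + 2 * m * y i + y i * y i)"
      by (simp add: dot_def y_def power2_eq_square algebra_simps)
    also have "\<dots> = real n * m\<^sup>2 + dot n y y"
      using y0 by (simp add: sum.distrib dot_def flip: sum_distrib_left)
    finally show ?thesis by (simp add: algebra_simps)
  qed
  finally show ?thesis .
qed

section \<open>Norm of the exponentially tilted walk operator\<close>

text \<open>Working with the norm weighted by \<open>g = e\<^bsup>t f\<^esup>\<close> amounts to conjugating by \<open>D\<^bsup>1/2\<^esup>\<close>.\<close>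

definition wnorm :: "nat \<Rightarrow> (nat \<Rightarrow> real) \<Rightarrow> (nat \<Rightarrow> real) \<Rightarrow> real" where
  "wnorm n g h = sqrt (\<Sum>v<n. g v * (h v)\<^sup>2)"

definition tilted :: "nat \<Rightarrow> (nat \<Rightarrow> nat \<Rightarrow> nat) \<Rightarrow> nat \<Rightarrow> (nat \<Rightarrow> real) \<Rightarrow> (nat \<Rightarrow> real) \<Rightarrow> nat \<Rightarrow> real" where
  "tilted n A d g h u = (\<Sum>v<n. real (A u v) / real d * (g v * h v))"

text \<open>Cauchy-Schwarz for \<open>sqrt g\<close> and \<open>sqrt g * h\<close>. It controls the
  rank-one averaging part of the operator.\<close>

lemma abs_weighted_sum_le:
  assumes "\<And>v. v < n \<Longrightarrow> g v \<ge> 0"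
  shows "\<bar>\<Sum>v<n. g v * h v\<bar> \<le> sqrt (\<Sum>v<n. g v) * wnorm n g h"
proof -
  have "dot n (\<lambda>v. sqrt (g v)) (\<lambda>v. sqrt (g v) * h v) = (\<Sum>v<n. g v * h v)"
    unfolding dot_def by (intro sum.cong) (simp_all add: assms flip: mult.assoc)
  moreover have "dot n (\<lambda>v. sqrt (g v)) (\<lambda>v. sqrt (g v)) = (\<Sum>v<n. g v)"
    unfolding dot_def by (intro sum.cong) (simp_all add: assms)
  moreover have "dot n (\<lambda>v. sqrt (g v) * h v) (\<lambda>v. sqrt (g v) * h v) = (\<Sum>v<n. g v * (h v)\<^sup>2)"
    unfolding dot_def by (intro sum.cong) (simp_all add: assms power_mult_distrib flip: power2_eq_square)
  ultimately show ?thesis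
    using dot_Cauchy_Schwarz[of n "\<lambda>v. sqrt (g v)" "\<lambda>v. sqrt (g v) * h v"] by (simp add: wnorm_def)
qed

lemma dot_weighted_le:
  assumes "\<And>v. v < n \<Longrightarrow> g v \<ge> 0" "\<And>v. v < n \<Longrightarrow> g v \<le> G"
  shows "sqrt (dot n (\<lambda>v. g v * h v) (\<lambda>v. g v * h v)) \<le> sqrt G * wnorm n g h"
proof -
  have "dot n (\<lambda>v. g v * h v) (\<lambda>v. g v * h v) \<le> (\<Sum>v<n. G * (g v * (h v)\<^sup>2))"
    unfolding dot_def
  proof (rule sum_mono)
    fix v assume "v \<in> {..<n}"
    then have "g v * (g v * (h v)\<^sup>2) \<le> G * (g v * (h v)\<^sup>2)"
      using assms by (intro mult_right_mono) auto
    then show "g v * h v * (g v * h v) \<le> G * (g v * (h v)\<^sup>2)"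
      by (simp add: power2_eq_square mult_ac)
  qed
  then show ?thesis
    by (simp add: wnorm_def flip: real_sqrt_mult sum_distrib_left)
qed

text \<open>Write the squared norm of the image \<open>k\<close> as the pairing of
  \<open>g * k\<close> with \<open>k\<close> and split the second factor into the part from
  \<open>J\<close> and the part from \<open>R\<close>. The first yields the mean of
  \<open>g\<close>, the second \<open>lam * G\<close>, each times both norms; one factor
  \<open>wnorm n g k\<close> is then cancelled.\<close>

lemma wnorm_tilted_le:
  assumes ex: "expander n A d lam" and lam: "0 \<le> lam" "lam \<le> 1" and n: "n \<ge> 1"
    and g: "\<And>v. v < n \<Longrightarrow> g v \<ge> 0" "\<And>v. v < n \<Longrightarrow> g v \<le> G"
  shows "wnorm n g (tilted n A d g h) \<le> ((1 - lam) * ((\<Sum>v<n. g v) / real n) + lam * G) * wnorm n g h"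
proof -
  define S where "S = (\<lambda>u v. real (A u v))"
  define R where "R = (\<lambda>x u. mul_vec n S x u - real d * (1 - lam) * ((\<Sum>i<n. x i) / real n))"
  define k where "k = tilted n A d g h"
  define \<sigma> where "\<sigma> = (\<Sum>v<n. g v)"
  have d: "d \<ge> 1" using ex by (simp add: expander_def regular_def)
  have G: "G \<ge> 0" using g[of 0] n by force
  have \<sigma>: "\<sigma> \<ge> 0" unfolding \<sigma>_def by (rule sum_nonneg) (use g in auto)
  have wn0: "wnorm n g x \<ge> 0" for x
    unfolding wnorm_def by (intro real_sqrt_ge_zero sum_nonneg mult_nonneg_nonneg) (use g in auto)
  have k_eq: "k u = (1 - lam) * ((\<Sum>v<n. g v * h v) / real n) + R (\<lambda>v. g v * h v) u / real d" for u
  proof -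
    have "k u = mul_vec n S (\<lambda>v. g v * h v) u / real d"
      by (simp add: k_def tilted_def mul_vec_def S_def sum_divide_distrib)
    then show ?thesis using d by (simp add: R_def diff_divide_distrib)
  qed
  have "(wnorm n g k)\<^sup>2 = (\<Sum>v<n. g v * k v * k v)"
    unfolding wnorm_def
    by (subst real_sqrt_pow2) (auto intro!: sum_nonneg sum.cong simp: g power2_eq_square)
  also have "\<dots> = (\<Sum>v<n. (1 - lam) * ((\<Sum>v<n. g v * h v) / real n) * (g v * k v)
      + (g v * k v) * R (\<lambda>v. g v * h v) v / real d)"
    \<comment> \<open>Only one of the two factors \<open>k v\<close> is expanded; the other stays
      for the pairing.\<close>
    by (subst (2) k_eq) (simp add: algebra_simps)
  also have "\<dots> = (1 - lam) * ((\<Sum>v<n. g v * h v) / real n) * (\<Sum>v<n. g v * k v)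
      + dot n (\<lambda>v. g v * k v) (R (\<lambda>v. g v * h v)) / real d"
    by (simp add: sum.distrib dot_def sum_divide_distrib flip: sum_distrib_left)
  also have "\<dots> \<le> (1 - lam) * (\<sigma> / real n) * wnorm n g h * wnorm n g k
      + lam * G * wnorm n g h * wnorm n g k"
  proof (rule add_mono)
    have "(\<Sum>v<n. g v * h v) * (\<Sum>v<n. g v * k v) \<le> \<bar>\<Sum>v<n. g v * h v\<bar> * \<bar>\<Sum>v<n. g v * k v\<bar>"
      by (metis abs_ge_self abs_mult)
    also have "\<dots> \<le> (sqrt \<sigma> * wnorm n g h) * (sqrt \<sigma> * wnorm n g k)"
      unfolding \<sigma>_def using g \<sigma> wn0
      by (intro mult_mono abs_weighted_sum_le) (auto simp: \<sigma>_def)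
    also have "\<dots> = (sqrt \<sigma> * sqrt \<sigma>) * (wnorm n g h * wnorm n g k)"
      by (simp only: mult_ac)
    also have "sqrt \<sigma> * sqrt \<sigma> = \<sigma>"
      using \<sigma> by simp
    finally have "(1 - lam) / real n * ((\<Sum>v<n. g v * h v) * (\<Sum>v<n. g v * k v))
        \<le> (1 - lam) / real n * (\<sigma> * (wnorm n g h * wnorm n g k))"
      using lam by (intro mult_left_mono) auto
    then show "(1 - lam) * ((\<Sum>v<n. g v * h v) / real n) * (\<Sum>v<n. g v * k v)
        \<le> (1 - lam) * (\<sigma> / real n) * wnorm n g h * wnorm n g k"
      by (simp add: mult_ac)
  next
    have "sqrt (dot n (R (\<lambda>v. g v * h v)) (R (\<lambda>v. g v * h v)))
        \<le> sqrt ((real d * lam)\<^sup>2 * dot n (\<lambda>v. g v * h v) (\<lambda>v. g v * h v))"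
      using expander_centered_norm_le[OF ex lam(1) n, of "\<lambda>v. g v * h v"]
      by (simp add: R_def S_def)
    also have "\<dots> = real d * lam * sqrt (dot n (\<lambda>v. g v * h v) (\<lambda>v. g v * h v))"
      using lam by (simp add: real_sqrt_mult)
    also have "\<dots> \<le> real d * lam * (sqrt G * wnorm n g h)"
      using lam g by (intro mult_left_mono dot_weighted_le) auto
    finally have R: "sqrt (dot n (R (\<lambda>v. g v * h v)) (R (\<lambda>v. g v * h v)))
        \<le> real d * lam * (sqrt G * wnorm n g h)" .
    have "dot n (\<lambda>v. g v * k v) (R (\<lambda>v. g v * h v)) \<le> sqrt (dot n (\<lambda>v. g v * k v) (\<lambda>v. g v * k v))
        * sqrt (dot n (R (\<lambda>v. g v * h v)) (R (\<lambda>v. g v * h v)))"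
      using dot_Cauchy_Schwarz abs_le_iff by blast
    also have "\<dots> \<le> (sqrt G * wnorm n g k) * (real d * lam * (sqrt G * wnorm n g h))"
      using R g G wn0 by (intro mult_mono dot_weighted_le) (auto simp: dot_self_nonneg)
    also have "\<dots> = (lam * (sqrt G * sqrt G) * wnorm n g h * wnorm n g k) * real d"
      by (simp only: mult_ac)
    also have "sqrt G * sqrt G = G"
      using G by simp
    finally show "dot n (\<lambda>v. g v * k v) (R (\<lambda>v. g v * h v)) / real d
        \<le> lam * G * wnorm n g h * wnorm n g k"
      using d by (simp add: divide_le_eq)
  qed
  also have "\<dots> = (((1 - lam) * (\<sigma> / real n) + lam * G) * wnorm n g h) * wnorm n g k"
    by (simp add: algebra_simps)
  finally have *: "wnorm n g k * wnorm n g k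
      \<le> (((1 - lam) * (\<sigma> / real n) + lam * G) * wnorm n g h) * wnorm n g k"
    by (simp add: power2_eq_square)
  have "wnorm n g k \<le> ((1 - lam) * (\<sigma> / real n) + lam * G) * wnorm n g h"
  proof (cases "wnorm n g k = 0")
    case True
    then show ?thesis using lam G \<sigma> wn0[of h] by simp
  next
    case False
    then have "wnorm n g k > 0" using wn0[of k] by simp
    with * show ?thesis by simp
  qed
  then show ?thesis by (simp add: k_def \<sigma>_def)
qed

text \<open>Each of the \<open>l\<close> steps costs a factor \<open>\<beta>\<close>. The start
  vector and the final pairing contribute \<open>sqrt \<sigma>\<close> each, and together with the
  division by \<open>n\<close> they give the mean of \<open>g\<close>, which costs one more
  \<open>\<beta>\<close>.\<close>

lemma weighted_sum_tilted_power_le: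
  assumes ex: "expander n A d lam" and lam: "0 \<le> lam" "lam \<le> 1" and n: "n \<ge> 1"
    and g: "\<And>v. v < n \<Longrightarrow> g v \<ge> 0" "\<And>v. v < n \<Longrightarrow> g v \<le> G"
  defines "\<beta> \<equiv> (1 - lam) * ((\<Sum>v<n. g v) / real n) + lam * G"
  shows "(\<Sum>v<n. g v * (tilted n A d g ^^ l) (\<lambda>_. 1) v) / real n \<le> \<beta> ^ Suc l"
proof -
  define \<sigma> where "\<sigma> = (\<Sum>v<n. g v)"
  have G: "G \<ge> 0" using g[of 0] n by force
  have \<sigma>: "\<sigma> \<ge> 0" unfolding \<sigma>_def by (rule sum_nonneg) (use g in auto)
  have "\<sigma> \<le> (\<Sum>v<n. G)" unfolding \<sigma>_def by (rule sum_mono) (use g in auto)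
  then have \<sigma>G: "\<sigma> / real n \<le> G" using n by (simp add: divide_le_eq mult.commute)
  have \<beta>0: "\<beta> \<ge> 0" using lam G \<sigma> by (simp add: \<beta>_def \<sigma>_def[symmetric])
  \<comment> \<open>\<open>\<beta>\<close> is a convex combination of the mean of \<open>g\<close>
    and \<open>G\<close>, which is at least that mean.\<close>
  have "\<sigma> / real n = (1 - lam) * (\<sigma> / real n) + lam * (\<sigma> / real n)"
    unfolding distrib_right[symmetric] by simp
  also have "\<dots> \<le> \<beta>" using mult_left_mono[OF \<sigma>G lam(1)] by (simp add: \<beta>_def \<sigma>_def)
  finally have \<sigma>\<beta>: "\<sigma> / real n \<le> \<beta>" .
  have pow: "wnorm n g ((tilted n A d g ^^ l) (\<lambda>_. 1)) \<le> \<beta> ^ l * sqrt \<sigma>"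
  proof (induction l)
    case 0
    show ?case by (simp add: wnorm_def \<sigma>_def)
  next
    case (Suc l)
    have "wnorm n g (tilted n A d g ((tilted n A d g ^^ l) (\<lambda>_. 1)))
        \<le> \<beta> * wnorm n g ((tilted n A d g ^^ l) (\<lambda>_. 1))"
      unfolding \<beta>_def by (rule wnorm_tilted_le[OF ex lam n g])
    also have "\<dots> \<le> \<beta> * (\<beta> ^ l * sqrt \<sigma>)" by (rule mult_left_mono[OF Suc \<beta>0])
    finally show ?case by simp
  qed
  have "(\<Sum>v<n. g v * (tilted n A d g ^^ l) (\<lambda>_. 1) v)
      \<le> sqrt \<sigma> * wnorm n g ((tilted n A d g ^^ l) (\<lambda>_. 1))"
    using abs_weighted_sum_le[of n g "(tilted n A d g ^^ l) (\<lambda>_. 1)"] g by (simp add: \<sigma>_def)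
  also have "\<dots> \<le> sqrt \<sigma> * (\<beta> ^ l * sqrt \<sigma>)"
    using pow \<sigma> by (intro mult_left_mono) auto
  also have "\<dots> = \<beta> ^ l * \<sigma>" using \<sigma> by (simp add: mult_ac)
  finally have "(\<Sum>v<n. g v * (tilted n A d g ^^ l) (\<lambda>_. 1) v) / real n \<le> \<beta> ^ l * (\<sigma> / real n)"
    using n by (simp add: divide_right_mono)
  also have "\<dots> \<le> \<beta> ^ l * \<beta>" using \<sigma>\<beta> \<beta>0 by (intro mult_left_mono) auto
  finally show ?thesis by (simp add: mult.commute)
qed

subsection \<open>Random walks\<close>

lemma
  assumes reg: "regular n A d" and u: "u < n"
  shows expectation_step_pmf: "measure_pmf.expectation (step_pmf n A u) h
      = (\<Sum>v<n. real (A u v) / real d * h v)"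
    and set_step_pmf_subset: "set_pmf (step_pmf n A u) \<subseteq> {..<n}"
proof -
  define M where "M = (\<Sum>v\<in>{..<n}. replicate_mset (A u v) v)"
  have row: "(\<Sum>v<n. A u v) = d" using reg u unfolding regular_def by blast
  have size: "size M = d" using row by (simp add: M_def)
  have "M \<noteq> {#}" using size reg by (auto simp: regular_def)
  have count: "count M v = A u v" if "v < n" for v
    using that by (simp add: M_def count_sum)
  have step: "step_pmf n A u = pmf_of_multiset M" by (simp add: step_pmf_def M_def)
  have "v < n" if "v \<in># M" for v
    using that by (auto simp: M_def set_mset_sum split: if_splits)
  then show sub: "set_pmf (step_pmf n A u) \<subseteq> {..<n}"
    using \<open>M \<noteq> {#}\<close> by (auto simp: step)
  show "measure_pmf.expectation (step_pmf n A u) h = (\<Sum>v<n. real (A u v) / real d * h v)"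
    using sub \<open>M \<noteq> {#}\<close> count size
    by (subst integral_measure_pmf[of "{..<n}"]) (auto simp: step)
qed

lemma set_walk_pmf_subset:
  assumes reg: "regular n A d" and n: "n \<ge> 1"
  shows "set_pmf (walk_pmf n A l) \<subseteq> {w. set w \<subseteq> {..<n} \<and> length w = l}"
proof (induction l)
  case (Suc l)
  have ne: "{..<n} \<noteq> {}" using n by (auto simp: lessThan_empty_iff)
  show ?case
  proof (cases "l = 0")
    case True
    then show ?thesis using ne by (auto simp: set_pmf_of_set)
  next
    case False
    have "set (w @ [v]) \<subseteq> {..<n} \<and> length (w @ [v]) = Suc l"
      if w: "w \<in> set_pmf (walk_pmf n A l)" and v: "v \<in> set_pmf (step_pmf n A (last w))" for w v
    proof -
      have *: "set w \<subseteq> {..<n}" "length w = l" using Suc w by auto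
      then have "last w < n" using False last_in_set[of w] by fastforce
      then show ?thesis using * v set_step_pmf_subset[OF reg] by auto
    qed
    then show ?thesis using False by fastforce
  qed
qed simp

lemma finite_set_walk_pmf:
  assumes "regular n A d" "n \<ge> 1"
  shows "finite (set_pmf (walk_pmf n A l))"
  by (rule finite_subset[OF set_walk_pmf_subset[OF assms] finite_lists_length_eq]) simp

text \<open>The test function \<open>h\<close> at the last vertex makes the induction work:
  averaging over the last step replaces \<open>h\<close> by \<open>tilted n A d g h\<close> on a
  walk one vertex shorter. A walk on \<open>Suc l\<close> vertices takes \<open>l\<close> steps, and
  the remaining factor \<open>g v\<close> weights the uniform start.\<close>

lemma expectation_walk_pmf:
  assumes reg: "regular n A d" and n: "n \<ge> 1"
  shows "measure_pmf.expectation (walk_pmf n A (Suc l)) (\<lambda>w. prod_list (map g w) * h (last w))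
    = (\<Sum>v<n. g v * (tilted n A d g ^^ l) h v) / real n"
proof (induction l arbitrary: h)
  case 0
  have "{..<n} \<noteq> {}" using n by (auto simp: lessThan_empty_iff)
  then show ?case by (simp add: integral_pmf_of_set)
next
  case (Suc l)
  define W where "W = set_pmf (walk_pmf n A (Suc l))"
  define E where "E w = map_pmf (\<lambda>v. w @ [v]) (step_pmf n A (last w))" for w
  have finW: "finite W" unfolding W_def by (rule finite_set_walk_pmf[OF assms])
  have last: "last w < n" if "w \<in> W" for w
  proof -
    have "set w \<subseteq> {..<n}" "length w = Suc l"
      using that set_walk_pmf_subset[OF assms, of "Suc l"] by (auto simp: W_def)
    then show ?thesis using last_in_set[of w] by fastforce
  qed
  have finE: "finite (set_pmf (E w))" if "w \<in> W" for w
    using finite_subset[OF set_step_pmf_subset[OF reg last[OF that]]] by (simp add: E_def)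
  have inner: "measure_pmf.expectation (E w) (\<lambda>w. prod_list (map g w) * h (last w))
      = prod_list (map g w) * tilted n A d g h (last w)" if "w \<in> W" for w
    by (simp add: E_def expectation_step_pmf[OF reg last[OF that]] tilted_def sum_distrib_left mult_ac)
  have "measure_pmf.expectation (walk_pmf n A (Suc (Suc l))) (\<lambda>w. prod_list (map g w) * h (last w))
      = measure_pmf.expectation (bind_pmf (walk_pmf n A (Suc l)) E) (\<lambda>w. prod_list (map g w) * h (last w))"
    by (simp only: walk_pmf.simps(2)[of n A "Suc l"] E_def[abs_def] nat.distinct if_False)
  also have "\<dots> = (\<Sum>w\<in>W. pmf (walk_pmf n A (Suc l)) w
      *\<^sub>R measure_pmf.expectation (E w) (\<lambda>w. prod_list (map g w) * h (last w)))"
    by (rule pmf_expectation_bind[OF finW finE]) (auto simp: W_def)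
  also have "\<dots> = (\<Sum>w\<in>W. pmf (walk_pmf n A (Suc l)) w
      *\<^sub>R (prod_list (map g w) * tilted n A d g h (last w)))"
    by (intro sum.cong) (simp_all add: inner)
  also have "\<dots> = measure_pmf.expectation (walk_pmf n A (Suc l))
      (\<lambda>w. prod_list (map g w) * tilted n A d g h (last w))"
    by (rule integral_measure_pmf[OF finW, symmetric]) (simp add: W_def)
  also have "\<dots> = (\<Sum>v<n. g v * (tilted n A d g ^^ l) (tilted n A d g h) v) / real n"
    by (rule Suc.IH)
  finally show ?case by (simp add: funpow_swap1)
qed

section \<open>The Chernoff argument\<close>

text \<open>Markov's inequality for \<open>exp (t * (\<Sum>i<l. f (w ! i)))\<close>, which is the
  product of the weights \<open>g\<close> along the walk.\<close>

lemma prob_walk_le: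
  assumes ex: "expander n A d lam" and lam: "0 \<le> lam" "lam \<le> 1" and n: "n \<ge> 1" and l: "l \<ge> 1"
    and f: "\<forall>v<n. f v \<in> {0, 1}" and \<mu>: "\<mu> = (\<Sum>v<n. f v) / real n" and t: "t \<ge> 0"
  shows "measure_pmf.prob (walk_pmf n A l) {w. (\<Sum>i<l. f (w ! i)) \<ge> \<gamma> * real l}
    \<le> (exp (- t * \<gamma>) * (1 + (\<mu> + lam) * (exp t - 1))) ^ l"
proof -
  define g where "g v = exp (t * f v)" for v
  define p where "p = walk_pmf n A l"
  define \<beta> where "\<beta> = (1 - lam) * ((\<Sum>v<n. g v) / real n) + lam * exp t"
  have reg: "regular n A d" using ex by (simp add: expander_def)
  obtain l' where l': "l = Suc l'" using l by (cases l) auto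
  have fin: "finite (set_pmf p)" unfolding p_def by (rule finite_set_walk_pmf[OF reg n])
  have len: "length w = l" if "w \<in> set_pmf p" for w
    using that set_walk_pmf_subset[OF reg n, of l] by (auto simp: p_def)
  have prod: "prod_list (map g w) = exp (t * (\<Sum>i<l. f (w ! i)))" if "length w = l" for w
  proof -
    have "prod_list (map g w) = (\<Prod>i<l. g (w ! i))"
      using that by (simp add: prod.list_conv_set_nth lessThan_atLeast0)
    also have "\<dots> = exp (\<Sum>i<l. t * f (w ! i))" by (simp add: g_def exp_sum)
    finally show ?thesis by (simp add: sum_distrib_left)
  qed
  have f01: "0 \<le> f v" "f v \<le> 1" "f v = 0 \<or> f v = 1" if "v < n" for v
    using f that by auto
  have g: "g v \<ge> 0" "g v \<le> exp t" if "v < n" for v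
    using f01(3)[OF that] t by (auto simp: g_def)
  \<comment> \<open>On the values 0 and 1 the function \<open>exp (t * x)\<close> is affine in
    \<open>x\<close>.\<close>
  have "(\<Sum>v<n. g v) = (\<Sum>v<n. 1 + (exp t - 1) * f v)"
    by (intro sum.cong) (use f01(3) in \<open>force simp: g_def\<close>)+
  also have "\<dots> = real n + (exp t - 1) * (\<Sum>v<n. f v)"
    by (simp add: sum.distrib sum_distrib_left)
  finally have avg: "(\<Sum>v<n. g v) / real n = 1 + (exp t - 1) * \<mu>"
    using n by (simp add: \<mu> add_divide_distrib)
  have \<mu>0: "\<mu> \<ge> 0" unfolding \<mu> by (intro divide_nonneg_nonneg sum_nonneg) (use f01 in auto)
  have \<beta>: "\<beta> = 1 + (\<mu> + lam) * (exp t - 1) - lam * \<mu> * (exp t - 1)"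
    unfolding \<beta>_def avg by (simp add: algebra_simps)
  \<comment> \<open>The dropped term \<open>lam * \<mu> * (exp t - 1)\<close> is nonnegative because
    \<open>t \<ge> 0\<close>.\<close>
  have \<beta>_le: "\<beta> \<le> 1 + (\<mu> + lam) * (exp t - 1)"
    unfolding \<beta> using lam \<mu>0 t by simp
  have \<beta>0: "\<beta> \<ge> 0" unfolding \<beta>_def avg using lam \<mu>0 t by simp
  have "measure_pmf.expectation p (\<lambda>w. prod_list (map g w))
      = (\<Sum>v<n. g v * (tilted n A d g ^^ l') (\<lambda>_. 1) v) / real n"
    using expectation_walk_pmf[OF reg n, of l' g "\<lambda>_. 1"] by (simp add: p_def l')
  also have "\<dots> \<le> \<beta> ^ l"
    unfolding l' \<beta>_def by (rule weighted_sum_tilted_power_le[OF ex lam n g])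
  also have "\<dots> \<le> (1 + (\<mu> + lam) * (exp t - 1)) ^ l"
    by (rule power_mono[OF \<beta>_le \<beta>0])
  finally have mgf: "measure_pmf.expectation p (\<lambda>w. prod_list (map g w))
      \<le> (1 + (\<mu> + lam) * (exp t - 1)) ^ l" .
  have "measure_pmf.prob p {w. (\<Sum>i<l. f (w ! i)) \<ge> \<gamma> * real l}
      = measure_pmf.expectation p (indicator {w. (\<Sum>i<l. f (w ! i)) \<ge> \<gamma> * real l})"
    by simp
  also have "\<dots> \<le> measure_pmf.expectation p (\<lambda>w. exp (- t * \<gamma> * real l) * prod_list (map g w))"
  proof (rule integral_mono_AE)
    show "AE w in measure_pmf p. indicator {w. (\<Sum>i<l. f (w ! i)) \<ge> \<gamma> * real l} w
        \<le> exp (- t * \<gamma> * real l) * prod_list (map g w)"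
    proof (rule AE_pmfI)
      fix w assume "w \<in> set_pmf p"
      then have eq: "exp (- t * \<gamma> * real l) * prod_list (map g w)
          = exp (t * ((\<Sum>i<l. f (w ! i)) - \<gamma> * real l))"
        by (simp add: prod[OF len] right_diff_distrib mult_ac flip: exp_add)
      \<comment> \<open>On the event the exponent is nonnegative, so the right side is at least 1;
        elsewhere it is still positive.\<close>
      show "indicator {w. (\<Sum>i<l. f (w ! i)) \<ge> \<gamma> * real l} w
          \<le> exp (- t * \<gamma> * real l) * prod_list (map g w)"
        unfolding eq using t by (auto simp: indicator_def)
    qed
  qed (auto intro: integrable_measure_pmf_finite[OF fin])
  also have "\<dots> = exp (- t * \<gamma> * real l) * measure_pmf.expectation p (\<lambda>w. prod_list (map g w))"
    by simp
  also have "\<dots> \<le> exp (- t * \<gamma> * real l) * (1 + (\<mu> + lam) * (exp t - 1)) ^ l"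
    by (intro mult_left_mono mgf) simp
  also have "\<dots> = (exp (- t * \<gamma>) * (1 + (\<mu> + lam) * (exp t - 1))) ^ l"
    by (simp add: power_mult_distrib exp_of_nat_mult[symmetric] mult_ac)
  finally show ?thesis by (simp add: p_def)
qed

section \<open>Optimising the exponent\<close>

lemma exp_ereal_KL_refl: "exp_ereal (- (ereal (real l) * KL p p)) = 1"
  by (auto simp: KL_def kl_term_def exp_ereal_def zero_ereal_def)

text \<open>The Legendre transform of the Bernoulli cumulant generating function is the divergence; the
  maximiser is \<open>t = ln (\<gamma>(1 - \<delta>) / (\<delta>(1 - \<gamma>)))\<close>, which recedes to infinity as \<open>\<delta> \<rightarrow> 0\<close> or
  \<open>\<gamma> \<rightarrow> 1\<close>.\<close>

lemma le_exp_KL_if_le_bernoulli_mgf: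
  fixes P \<delta> \<gamma> :: real
  assumes \<delta>: "0 \<le> \<delta>" "\<delta> \<le> \<gamma>" and \<gamma>: "\<gamma> \<le> 1" and l: "l \<ge> 1" and "P \<le> 1"
    and P: "\<And>t. t \<ge> 0 \<Longrightarrow> P \<le> (exp (- t * \<gamma>) * (1 + \<delta> * (exp t - 1))) ^ l"
  shows "P \<le> exp_ereal (- (ereal (real l) * KL \<gamma> \<delta>))"
proof -
  \<comment> \<open>This serves the boundary cases, where the optimal bound is only approached as
    \<open>t\<close> tends to infinity.\<close>
  have lim: "P \<le> c ^ l"
    if "((\<lambda>t. exp (- t * \<gamma>) * (1 + \<delta> * (exp t - 1))) \<longlongrightarrow> c) at_top" for c
    by (rule tendsto_lowerbound[OF tendsto_power[OF that]])
      (rule eventually_mono[OF eventually_ge_at_top[of 0] P], simp_all)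
  \<comment> \<open>The divergence is 0 in the first case, infinite in the second and
    \<open>ln (1 / \<delta>)\<close> in the third. Only the last case has a finite positive
    maximiser.\<close>
  consider "\<gamma> = \<delta>" | "\<delta> = 0" "\<gamma> > 0" | "0 < \<delta>" "\<delta> < 1" "\<gamma> = 1" | "0 < \<delta>" "\<delta> < \<gamma>" "\<gamma> < 1"
    using \<delta> \<gamma> by fastforce
  then show ?thesis
  proof cases
    case 1
    then show ?thesis using \<open>P \<le> 1\<close> by (simp add: exp_ereal_KL_refl)
  next
    case 2
    have "((\<lambda>t. exp (- t * \<gamma>)) \<longlongrightarrow> 0) at_top" using \<open>\<gamma> > 0\<close> by real_asymp
    then have "P \<le> 0 ^ l" using \<open>\<delta> = 0\<close> by (intro lim) simp
    then have "P \<le> 0" using l by (simp add: power_0_left)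
    moreover have "exp_ereal x \<ge> 0" for x by (cases x) (auto simp: exp_ereal_def)
    ultimately show ?thesis using order_trans by blast
  next
    case 3
    have "((\<lambda>t. exp (- t) * (1 + \<delta> * (exp t - 1))) \<longlongrightarrow> \<delta>) at_top"
      using \<open>0 < \<delta>\<close> by real_asymp
    then have "P \<le> \<delta> ^ l" using \<open>\<gamma> = 1\<close> by (intro lim) simp
    also have "\<delta> ^ l = exp (- (real l * ln (1 / \<delta>)))"
      using 3 by (simp add: ln_div exp_of_nat_mult)
    also have "\<dots> = exp_ereal (- (ereal (real l) * KL \<gamma> \<delta>))"
      using 3 by (simp add: KL_def kl_term_def exp_ereal_def)
    finally show ?thesis .
  next
    case 4
    define r where "r = \<gamma> * (1 - \<delta>) / (\<delta> * (1 - \<gamma>))"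
    \<comment> \<open>\<open>\<delta> < \<gamma>\<close> makes the maximiser \<open>ln r\<close>
      nonnegative, hence admissible in \<open>P\<close>.\<close>
    have "\<delta> * (1 - \<gamma>) \<le> \<gamma> * (1 - \<delta>)" using 4 by (simp add: algebra_simps)
    then have r: "r \<ge> 1" using 4 by (simp add: r_def)
    have lnr: "ln r = ln \<gamma> + ln (1 - \<delta>) - (ln \<delta> + ln (1 - \<gamma>))"
      using 4 by (simp add: r_def ln_div ln_mult)
    have "1 + \<delta> * (r - 1) = (1 - \<delta>) / (1 - \<gamma>)"
      using 4 by (simp add: r_def divide_simps) (simp add: algebra_simps)
    also have "\<dots> = exp (ln ((1 - \<delta>) / (1 - \<gamma>)))" using 4 by simp
    finally have m: "1 + \<delta> * (r - 1) = exp (ln ((1 - \<delta>) / (1 - \<gamma>)))" .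
    have "P \<le> (exp (- ln r * \<gamma>) * (1 + \<delta> * (r - 1))) ^ l"
      using P[of "ln r"] r by simp
    also have "\<dots> = exp (real l * (- ln r * \<gamma> + ln ((1 - \<delta>) / (1 - \<gamma>))))"
      by (simp only: m exp_of_nat_mult exp_add)
    also have "- ln r * \<gamma> + ln ((1 - \<delta>) / (1 - \<gamma>)) = - (\<gamma> * ln (\<gamma> / \<delta>) + (1 - \<gamma>) * ln ((1 - \<gamma>) / (1 - \<delta>)))"
      using 4 by (simp add: lnr ln_div algebra_simps)
    also have "exp (real l * \<dots>) = exp_ereal (- (ereal (real l) * KL \<gamma> \<delta>))"
      using 4 by (simp add: KL_def kl_term_def exp_ereal_def algebra_simps)
    finally show ?thesis .
  qed
qed

theorem theorem3:
  fixes n d l :: nat and A :: "nat \<Rightarrow> nat \<Rightarrow> nat" and lam \<gamma> :: real and f :: "nat \<Rightarrow> real"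
  assumes "n \<ge> 1"
    and "expander n A d lam"
    and "lam \<ge> 0"
    and "l \<ge> 1"
    and "\<forall>v<n. f v \<in> {0, 1}"
    and "\<mu> = (\<Sum>v<n. f v) / real n"
    and "\<mu> + lam \<le> \<gamma>" and "\<gamma> \<le> 1"
  shows "measure_pmf.prob (walk_pmf n A l) {w. (\<Sum>i<l. f (w ! i)) \<ge> \<gamma> * real l}
           \<le> exp_ereal (- (ereal (real l) * KL \<gamma> (\<mu> + lam)))"
proof -
  have \<mu>: "\<mu> \<ge> 0"
    unfolding assms(6) by (intro divide_nonneg_nonneg sum_nonneg) (use assms(5) in force)+
  \<comment> \<open>The norm estimate uses \<open>1 - lam\<close> as a nonnegative weight.\<close>
  then have lam: "lam \<le> 1" using assms(7,8) by simp
  show ?thesis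
  proof (rule le_exp_KL_if_le_bernoulli_mgf)
    show "measure_pmf.prob (walk_pmf n A l) {w. (\<Sum>i<l. f (w ! i)) \<ge> \<gamma> * real l}
        \<le> (exp (- t * \<gamma>) * (1 + (\<mu> + lam) * (exp t - 1))) ^ l" if "t \<ge> 0" for t
      by (rule prob_walk_le[OF assms(2,3) lam assms(1,4,5,6) that])
  qed (use assms \<mu> in auto)
qed

end
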